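(* For every positive integer $N$, \begin{equation*} F_N(a,b;t)= 1+\frac{t(1-aq)(1-q^{N+1})}{(1-bq)(1-tq^N)}F_N(aq,bq;t). \end{equation*}
   Context: Let $|q|<1$ and use the $q$-Pochhammer notation $(A)_0=(A;q)_0=1$, $(A)_n=(A;q)_n=(1-A)(1-Aq)\cdots(1-Aq^{n-1})$ for $n\ge 1$, and the Gaussian binomial coefficient $\begin{bmatrix} N\\ n\end{bmatrix}=\frac{(q)_N}{(q)_n(q)_{N-n}}$. For $N\in\mathbb{N}$ the finite analogue of Fine's function is defined by \begin{equation*} F_{N}(a,b;t):=\sum_{n=0}^{N}\begin{bmatrix} N\\ n\end{bmatrix}\frac{(a q)_{n}(t)_{N-n}(q)_n t^{n}}{(b q)_{n}(t)_N }. \end{equation*} Parameters $a,b,t$ are such that all denominators are nonzero.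
   Formalization: The left-hand side is F_{N+1}(a,b;t) instead of the printed F_N(a,b;t), because the printed identity is false: for N=1, q=1/2, a=b=0, t=1/3 its left side is 5/4 and its right side is 11/8. *)

theory Defs
  imports Complex_Main
begin

text \<open>\<open>qpoch A q n\<close> is \<open>(A; q)\<^sub>n\<close>; the base \<open>q\<close> is always an explicit argument.\<close>

definition qpoch :: "complex \<Rightarrow> complex \<Rightarrow> nat \<Rightarrow> complex" where
  "qpoch A q n = (\<Prod>k<n. 1 - A * q ^ k)"

text \<open>Only meaningful for \<open>n \<le> N\<close>, because of the truncated subtraction \<open>N - n\<close>.\<close>

definition qbinom :: "complex \<Rightarrow> nat \<Rightarrow> nat \<Rightarrow> complex" where
  "qbinom q N n = qpoch q q N / (qpoch q q n * qpoch q q (N - n))"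

definition fine_F :: "complex \<Rightarrow> nat \<Rightarrow> complex \<Rightarrow> complex \<Rightarrow> complex \<Rightarrow> complex" where
  "fine_F q N a b t =
     (\<Sum>n=0..N. qbinom q N n *
        (qpoch (a * q) q n * qpoch t q (N - n) * qpoch q q n * t ^ n)
        / (qpoch (b * q) q n * qpoch t q N))"

end

theory Submission
  imports Defs
begin

text \<open>The recurrence holds term by term: the summand \<open>n = 0\<close> of the left side is
  1, and the summand \<open>n = m + 1\<close> is the prefactor times the summand \<open>m\<close> of
  the sum on the right. Peeling the first factor off \<open>(aq)_(m+1)\<close> and
  \<open>(bq)_(m+1)\<close> shifts a, b to aq, bq (\<open>qpoch_Suc_shift\<close>); peeling the last
  factor off \<open>(q)_(N+1)\<close> and \<open>(t)_(N+1)\<close> lowers N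
  (\<open>qpoch_Suc\<close>).\<close>

lemma qpoch_0: "qpoch A q 0 = 1"
  by (simp add: qpoch_def)

lemma qpoch_Suc: "qpoch A q (Suc n) = qpoch A q n * (1 - A * q ^ n)"
  by (simp add: qpoch_def)

lemma qpoch_Suc_shift: "qpoch A q (Suc n) = (1 - A) * qpoch (A * q) q n"
  unfolding qpoch_def by (subst prod.lessThan_Suc_shift) (simp add: mult.assoc)

text \<open>Every factor is 1 minus a positive power of q, and such a power has norm at most |q| <
  1.\<close>

lemma qpoch_q_q_nonzero:
  assumes "norm q < 1"
  shows "qpoch q q n \<noteq> 0"
proof -
  have "q * q ^ k \<noteq> 1" for k
  proof
    assume "q * q ^ k = 1"
    then have "norm q * norm q ^ k = 1"
      by (metis norm_mult norm_one norm_power)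
    moreover have "norm q * norm q ^ k \<le> norm q"
      using assms by (simp add: mult_left_le power_le_one)
    ultimately show False using assms by simp
  qed
  then show ?thesis by (auto simp: qpoch_def)
qed

text \<open>After this cancellation n enters only through \<open>N - n\<close>, which is unchanged
  when N and n both grow by 1.\<close>

lemma qbinom_mult_qpoch:
  assumes "norm q < 1"
  shows "qbinom q N n * qpoch q q n = qpoch q q N / qpoch q q (N - n)"
  using qpoch_q_q_nonzero[OF assms] by (simp add: qbinom_def)

theorem theorem3p1:
  fixes q a b t :: complex and N :: nat
  assumes "norm q < 1"
    and "N \<ge> 1"
    and "qpoch (b * q) q (N + 1) \<noteq> 0"
    and "qpoch t q (N + 1) \<noteq> 0"
  shows "fine_F q (N + 1) a b t =
    1 + t * (1 - a * q) * (1 - q ^ (N + 1)) / ((1 - b * q) * (1 - t * q ^ N))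
        * fine_F q N (a * q) (b * q) t"
proof -
  define T where "T M c d n = (qbinom q M n * qpoch q q n) *
      (qpoch (c * q) q n * qpoch t q (M - n) * t ^ n) / (qpoch (d * q) q n * qpoch t q M)" for M c d n
  let ?C = "t * (1 - a * q) * (1 - q ^ (N + 1)) / ((1 - b * q) * (1 - t * q ^ N))"
  have F: "fine_F q M c d t = (\<Sum>n=0..M. T M c d n)" for M c d
    by (simp add: fine_F_def T_def mult_ac)
  \<comment> \<open>What remains is \<open>(t)_(N+1) / (t)_(N+1)\<close>, hence the nonvanishing of
    \<open>qpoch t q (N + 1)\<close>.\<close>
  have T0: "T (N + 1) a b 0 = 1"
    using assms(4) qpoch_q_q_nonzero[OF assms(1)]
    by (simp add: T_def qbinom_def qpoch_0)
  \<comment> \<open>No bound on m is required: \<open>N + 1 - Suc m = N - m\<close> also under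
    truncated subtraction.\<close>
  have step: "T (N + 1) a b (Suc m) = ?C * T N (a * q) (b * q) m" for m
  proof -
    have "qbinom q (N + 1) (Suc m) * qpoch q q (Suc m)
        = (1 - q ^ (N + 1)) * (qbinom q N m * qpoch q q m)"
      unfolding qbinom_mult_qpoch[OF assms(1)] by (simp add: qpoch_Suc[of q q N])
    then show ?thesis
      unfolding T_def by (simp add: qpoch_Suc[of t q N] qpoch_Suc_shift[of _ q m] mult_ac del: power_Suc)
        (simp add: mult_ac)
  qed
  have "fine_F q (N + 1) a b t = T (N + 1) a b 0 + (\<Sum>m=0..N. T (N + 1) a b (Suc m))"
    using sum.atLeast0_atMost_Suc_shift[of "T (N + 1) a b" N] by (simp add: F)
  then show ?thesis
    by (simp only: T0 step F sum_distrib_left)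
qed

end
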